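(* Let $\ell\in\mathbb{Z}_{\ge0}$ and let $\mathcal{C}$ denote the boundary complex of a $d$-dimensional $\ell$-fold capped cubical polytope. Then the $h$-polynomial $h(\mathrm{sd}(\mathcal{C});x)$ of the barycentric subdivision of $\mathcal{C}$ is real-rooted.
   Context: A cubical polytope is a (convex) polytope all of whose facets are combinatorial cubes. A polytope $P$ is capped over a cubical polytope $Q$ if there is a combinatorial cube $C$ (of the same dimension) such that $P=Q\cup C$ and $F:=Q\cap C$ is a facet of $Q$; combinatorially, the boundary complex of $P$ is obtained from that of $Q$ by subdividing the facet $F$ into the Schlegel diagram of a $d$-cube based at a facet identified with $F$. A polytope is $\ell$-fold capped cubical if it can be obtained from a combinatorial cube by $\ell$ capping operations. The boundary complex of a polytope is the polytopal complex of its proper faces (including $\emptyset$). The barycentric subdivision $\mathrm{sd}(\mathcal{C})$ of a polytopal complex $\mathcal{C}$ is the simplicial complex whose $k$-dimensional faces are the sets $\{F_0,\ldots,F_k\}$ of faces of $\mathcal{C}$ with $\emptyset\subsetneq F_0\subsetneq\cdots\subsetneq F_k$ (together with the empty face). For an $(m-1)$-dimensional complex $\mathcal{K}$, $f(\mathcal{K};x)=\sum_{k=-1}^{m-1}f_k(\mathcal{K})x^{k+1}$, where $f_k$ is the number of $k$-dimensional faces ($f_{-1}=1$), and $h(\mathcal{K};x)=(1-x)^m f(\mathcal{K};\frac{x}{1-x})$. A real polynomial is real-rooted if it is identically zero or has only real zeros. *)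

theory Defs
  imports
    "HOL-Analysis.Polytope"
    "HOL-Computational_Algebra.Polynomial"
begin

section \<open>Combinatorial cubes and capped cubical polytopes\<close>

definition combinatorially_equivalent ::
    "'a::euclidean_space set \<Rightarrow> 'b::euclidean_space set \<Rightarrow> bool" where
  "combinatorially_equivalent P Q \<longleftrightarrow>
     (\<exists>\<phi>. bij_betw \<phi> {F. F face_of P} {G. G face_of Q} \<and>
          (\<forall>F G. F face_of P \<longrightarrow> G face_of P \<longrightarrow> (F \<subseteq> G \<longleftrightarrow> \<phi> F \<subseteq> \<phi> G)))"

text \<open>
  For \<open>B \<subseteq> Basis\<close> the box \<open>cbox 0 (\<Sum>B)\<close> is the standard unit cube \<open>[0,1]^B\<close> of dimension
  \<open>card B\<close>, lying in the coordinate subspace spanned by \<open>B\<close>.  Every cube dimension that can occur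
  for a polytope in \<open>'a\<close> arises in this way; \<open>B = {}\<close> gives the point.
\<close>

definition combinatorial_cube :: "'a::euclidean_space set \<Rightarrow> bool" where
  "combinatorial_cube P \<longleftrightarrow>
     polytope P \<and> (\<exists>B \<subseteq> Basis. combinatorially_equivalent P (cbox (0::'a) (\<Sum>B)))"

definition cubical_polytope :: "'a::euclidean_space set \<Rightarrow> bool" where
  "cubical_polytope P \<longleftrightarrow> polytope P \<and> (\<forall>F. F facet_of P \<longrightarrow> combinatorial_cube F)"

text \<open>The empty face belongs to the boundary complex; \<open>{} face_of P\<close> holds for every \<open>P\<close>.\<close>

definition boundary_complex :: "'a::euclidean_space set \<Rightarrow> 'a set set" where
  "boundary_complex P = {F. F face_of P \<and> F \<noteq> P}"

text \<open>
  The last conjunct says that the boundary complex of \<open>P\<close> arises from that of \<open>Q\<close> by subdividing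
  the facet \<open>F = Q \<inter> C\<close> into the Schlegel diagram of \<open>C\<close> based at \<open>F\<close>: the facet \<open>F\<close> itself
  disappears and is replaced by the proper faces of \<open>C\<close> other than \<open>F\<close>.  It does not follow from
  the preceding conjuncts: stacking two unit squares into a rectangle merges pairs of collinear
  edges, and this is not a capping.
\<close>

definition capped_over :: "'a::euclidean_space set \<Rightarrow> 'a set \<Rightarrow> bool" where
  "capped_over P Q \<longleftrightarrow>
     polytope P \<and> cubical_polytope Q \<and>
     (\<exists>C. combinatorial_cube C \<and> aff_dim C = aff_dim Q \<and>
          P = Q \<union> C \<and> (Q \<inter> C) facet_of Q \<and>
          boundary_complex P = (boundary_complex Q \<union> boundary_complex C) - {Q \<inter> C})"

inductive capped_cubical :: "nat \<Rightarrow> 'a::euclidean_space set \<Rightarrow> bool" where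
  cube: "combinatorial_cube P \<Longrightarrow> capped_cubical 0 P"
| cap: "capped_cubical l Q \<Longrightarrow> capped_over P Q \<Longrightarrow> capped_cubical (Suc l) P"


section \<open>Barycentric subdivision and h-polynomials\<close>

text \<open>
  Abstract simplicial complexes are sets of finite sets containing the empty face; a face with
  \<open>k\<close> elements has dimension \<open>k - 1\<close>.
\<close>

definition barycentric_subdivision :: "'a set set \<Rightarrow> 'a set set set" where
  "barycentric_subdivision \<C> = {S. finite S \<and> subset.chain (\<C> - {{}}) S}"

text \<open>For a complex of dimension \<open>m - 1\<close>, this is \<open>m\<close>.\<close>

definition complex_rank :: "'b set set \<Rightarrow> nat" where
  "complex_rank K = Max (card ` K)"

text \<open>The number of \<open>(k - 1)\<close>-dimensional faces; the index is shifted so as to start at \<open>0\<close>.\<close>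

definition num_faces :: "'b set set \<Rightarrow> nat \<Rightarrow> nat" where
  "num_faces K k = card {S \<in> K. card S = k}"

definition f_poly :: "'b set set \<Rightarrow> real poly" where
  "f_poly K = (\<Sum>k\<le>complex_rank K. monom (of_nat (num_faces K k)) k)"

text \<open>
  \<open>(1 - x)^m f(x / (1 - x))\<close> with denominators cleared; see \<open>poly_h_poly\<close> below.
\<close>

definition h_poly :: "'b set set \<Rightarrow> real poly" where
  "h_poly K = (\<Sum>k\<le>complex_rank K.
     monom (of_nat (num_faces K k)) k * [:1, -1:] ^ (complex_rank K - k))"

lemma poly_h_poly:
  fixes x :: real
  assumes "x \<noteq> 1"
  shows "poly (h_poly K) x = (1 - x) ^ complex_rank K * poly (f_poly K) (x / (1 - x))"
proof -
  have "of_nat (num_faces K k) * x ^ k * (1 - x) ^ (complex_rank K - k) =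
        (1 - x) ^ complex_rank K * (of_nat (num_faces K k) * (x / (1 - x)) ^ k)"
    if "k \<le> complex_rank K" for k
    using assms that by (simp add: power_diff power_divide)
  then have "(\<Sum>k\<le>complex_rank K. of_nat (num_faces K k) * x ^ k * (1 - x) ^ (complex_rank K - k)) =
      (\<Sum>k\<le>complex_rank K. (1 - x) ^ complex_rank K * (of_nat (num_faces K k) * (x / (1 - x)) ^ k))"
    by (intro sum.cong refl) (metis atMost_iff)
  then show ?thesis
    by (simp add: h_poly_def f_poly_def poly_sum poly_monom sum_distrib_left)
qed

definition real_rooted :: "real poly \<Rightarrow> bool" where
  "real_rooted p \<longleftrightarrow>
     p = 0 \<or> (\<forall>z::complex. poly (map_poly complex_of_real p) z = 0 \<longrightarrow> z \<in> \<real>)"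

end

theory Submission imports Defs begin

text \<open>
  Sorting the chains of faces by their largest face expresses the \<open>f\<close>-polynomial of the barycentric
  subdivision of a boundary complex through those of the smaller faces, so that for the \<open>n\<close>-cube
  it is a polynomial \<open>b\<^sub>n\<close> with \<open>b\<^sub>n = 1 + y (\<Sum>j<n. (n choose j) 2^(n - j) b\<^sub>j)\<close>, which is
  equivalent to \<open>b\<^sub>n\<^sub>+\<^sub>1 = (1 + 2y) b\<^sub>n + 2 y (1 + y) b\<^sub>n'\<close>.  Capping a polytope of dimension \<open>n + 1\<close>
  adds the boundary of a cube, identifies two copies of the faces of the facet and removes that
  facet; this changes the polynomial by \<open>b\<^sub>n\<^sub>+\<^sub>1 - (1 + 2y) b\<^sub>n\<close>.  After \<open>\<ell>\<close> cappings one
  has \<open>(1 + 2y) b\<^sub>n + 2 (\<ell> + 1) y (1 + y) b\<^sub>n'\<close>, and Rolle's theorem applied to a power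
  of \<open>- y (1 + y)\<close> times \<open>b\<^sub>n\<close> produces one more root in \<open>(-1, 0)\<close> than \<open>b\<^sub>n\<close> has.  The
  substitution \<open>y = x / (1 - x)\<close> carries real-rootedness over to the \<open>h\<close>-polynomial.
\<close>

subsection \<open>Real-rooted polynomials\<close>

text \<open>A counting form of repeated use of Rolle's theorem. When a new maximum is added to the
  set, the point found between the old maximum and the new one lies above all earlier points, so it
  is a further one.\<close>

lemma exists_between_finite:
  fixes A :: "'a::linorder set"
  assumes "finite A" "A \<noteq> {}"
    and step: "\<And>x y. x \<in> A \<Longrightarrow> y \<in> A \<Longrightarrow> x < y \<Longrightarrow> \<exists>z. x < z \<and> z < y \<and> Q z"
  shows "\<exists>Z. finite Z \<and> Suc (card Z) = card A \<and> Z \<subseteq> {Min A<..<Max A} \<and> (\<forall>z\<in>Z. Q z)"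
  using assms
proof (induction A rule: finite_linorder_max_induct)
  case empty
  then show ?case by simp
next
  case (insert b A)
  show ?case
  proof (cases "A = {}")
    case True
    then show ?thesis by (intro exI[of _ "{}"]) auto
  next
    case False
    with insert obtain Z where Z: "finite Z" "Suc (card Z) = card A" "Z \<subseteq> {Min A<..<Max A}"
      "\<forall>z\<in>Z. Q z" by auto
    have "Max A \<in> A" using False insert by simp
    then obtain z where z: "Max A < z" "z < b" "Q z"
      using insert.prems(2)[of "Max A" b] insert.hyps by auto
    have "Min A \<le> Max A" using False insert.hyps by simp
    have "Max A < b" using z by simp
    have "Max (insert b A) = b" "Min (insert b A) = Min A"
      using False \<open>finite A\<close> \<open>Max A < b\<close> \<open>Min A \<le> Max A\<close> by simp_all
    moreover have "z \<notin> Z" using Z z by fastforce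
    moreover have "b \<notin> A" using insert.hyps by blast
    ultimately show ?thesis
      using Z z \<open>Max A < b\<close> \<open>Min A \<le> Max A\<close> insert.hyps
      by (intro exI[of _ "insert z Z"]) (force simp: subset_iff)
  qed
qed

text \<open>
  Rolle's theorem for \<open>(- x (1 + x)) powr (1 / a) * p x\<close>, which vanishes at \<open>-1\<close>, at \<open>0\<close> and at
  the given roots of \<open>p\<close>.
\<close>

lemma roots_of_derivative_operator:
  fixes p :: "real poly"
  assumes "a > 0" "finite A" "A \<subseteq> {-1<..<0}" "\<forall>x\<in>A. poly p x = 0"
  shows "\<exists>Z. finite Z \<and> card Z = Suc (card A) \<and> Z \<subseteq> {-1<..<0} \<and>
    (\<forall>z\<in>Z. poly ([:1, 2:] * p + smult a ([:0, 1, 1:] * pderiv p)) z = 0)"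
proof -
  \<comment> \<open>With the exponent \<open>1 / a\<close> the logarithmic derivative of the power
    is \<open>(1 + 2 * x) / (a * (x * (1 + x)))\<close>, so clearing denominators in the derivative
    of \<open>g\<close> leaves exactly the operator of the claim.\<close>
  define g where "g x = (- x * (1 + x)) powr (1 / a) * poly p x" for x :: real
  \<comment> \<open>The two endpoints are additional zeros of \<open>g\<close>, so
    \<open>card A + 2\<close> zeros leave \<open>card A + 1\<close> gaps.\<close>
  define B where "B = insert (-1) (insert 0 A)"
  have B: "finite B" "card B = Suc (Suc (card A))" "B \<subseteq> {-1..0}"
    using assms unfolding B_def by (auto simp: card_insert_if)
  have "Min B = -1" by (rule Min_eqI) (use B in \<open>auto simp: B_def\<close>)
  have "Max B = 0" by (rule Max_eqI) (use B in \<open>auto simp: B_def\<close>)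
  have gB: "g x = 0" if "x \<in> B" for x
    using that assms by (auto simp: g_def B_def)
  have "\<exists>z. x < z \<and> z < y \<and> poly ([:1, 2:] * p + smult a ([:0, 1, 1:] * pderiv p)) z = 0"
    if "x \<in> B" "y \<in> B" "x < y" for x y
  proof -
    have xy: "-1 \<le> x" "y \<le> 0" using B that by auto
    define D where "D z = (- z * (1 + z)) powr (1 / a) * poly (pderiv p) z +
        (- z * (1 + z)) powr (1 / a) * ((-1-2*z) * (1 / a) / (- z * (1 + z))) * poly p z"
      for z
    have "\<exists>z. x < z \<and> z < y \<and> (*) (D z) = (\<lambda>v. 0)"
    proof (rule Rolle_deriv[where f = g])
      \<comment> \<open>At -1 and 0 only continuity is required, and the positive exponent provides
        it; strictly between them the base of the power is positive.\<close>
      show "continuous_on {x..y} g"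
        unfolding g_def using xy \<open>a > 0\<close>
        by (intro continuous_intros continuous_on_powr') (auto simp: mult_nonneg_nonpos2 mult_nonpos_nonneg)
      show "(g has_derivative (*) (D z)) (at z)" if z: "x < z" "z < y" for z
      proof -
        have pos: "- z * (1 + z) > 0" using z xy by (simp add: mult_neg_pos)
        have "((\<lambda>x. (- x * (1 + x)) powr (1 / a)) has_real_derivative
            (- z * (1 + z)) powr (1 / a) * (0 * ln (- z * (1 + z)) + (-1-2*z) * (1 / a) / (- z * (1 + z)))) (at z)"
          by (rule has_real_derivative_powr') (use pos in \<open>auto intro!: derivative_eq_intros\<close>)
        from DERIV_mult[OF this poly_DERIV[of p z]] show ?thesis
          unfolding g_def has_field_derivative_def D_def by (simp add: ac_simps)
      qed
    qed (use that gB in auto)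
    then obtain z where z: "x < z" "z < y" and "(*) (D z) = (\<lambda>v. 0)" by blast
    then have D: "D z = 0" by (metis mult.right_neutral)
    have pos: "- z * (1 + z) > 0" using z xy by (simp add: mult_neg_pos)
    have "D z = (- z * (1 + z)) powr (1 / a) / (a * (z * (1 + z))) *
        ((1 + 2 * z) * poly p z + a * (z * (1 + z) * poly (pderiv p) z))"
      using pos \<open>a > 0\<close> unfolding D_def by (simp add: divide_simps) (simp add: algebra_simps)
    with D pos \<open>a > 0\<close> have "(1 + 2 * z) * poly p z + a * (z * (1 + z) * poly (pderiv p) z) = 0"
      by auto
    then show ?thesis using z by (intro exI[of _ z]) (simp add: algebra_simps)
  qed
  from exists_between_finite[OF \<open>finite B\<close> _ this] show ?thesis
    using \<open>Min B = -1\<close> \<open>Max B = 0\<close> B by (auto simp: B_def)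
qed

text \<open>A nonzero polynomial of degree at most \<open>card A\<close> has at most
  \<open>card A\<close> complex zeros, so the embedded set \<open>A\<close> already exhausts
  them.\<close>

lemma real_rooted_if_card_roots:
  fixes p :: "real poly"
  assumes "finite A" "degree p \<le> card A" "\<forall>x\<in>A. poly p x = 0"
  shows "real_rooted p"
proof (cases "p = 0")
  case False
  let ?q = "map_poly complex_of_real p"
  have q: "?q \<noteq> 0" using False by (metis degree_0 map_poly_0 map_poly_eq_0_iff of_real_eq_0_iff of_real_0)
  have "degree ?q = degree p" by (intro degree_map_poly) auto
  have "of_real ` A \<subseteq> {z. poly ?q z = 0}"
  proof clarify
    fix x assume "x \<in> A"
    have "poly ?q (of_real x) = of_real (poly p x)"
      by (induction p) (auto simp: map_poly_pCons)
    then show "poly ?q (of_real x) = 0" using assms \<open>x \<in> A\<close> by simp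
  qed
  moreover have "card {z. poly ?q z = 0} \<le> card (complex_of_real ` A)"
    using card_poly_roots_bound[OF q] assms(2) \<open>degree ?q = _\<close>
    by (simp add: card_image inj_on_def)
  ultimately have "of_real ` A = {z. poly ?q z = 0}"
    using poly_roots_finite[OF q] by (intro card_seteq)
  then show ?thesis unfolding real_rooted_def Reals_def by blast
qed (simp add: real_rooted_def)

section \<open>Transfer of real-rootedness from f-polynomials to h-polynomials\<close>

lemma map_poly_of_real_add:
  "map_poly of_real (p + q) = map_poly of_real p + (map_poly of_real q :: 'a::real_algebra_1 poly)"
  by (rule poly_eqI) (simp add: coeff_map_poly)

lemma map_poly_of_real_sum:
  "map_poly of_real (sum p A) = (\<Sum>x\<in>A. map_poly of_real (p x) :: 'a::real_algebra_1 poly)"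
  by (induction A rule: infinite_finite_induct) (simp_all add: map_poly_of_real_add)

lemma map_poly_of_real_mult:
  "map_poly of_real (p * q) = map_poly of_real p * (map_poly of_real q :: 'a::{real_algebra_1,comm_ring_1} poly)"
  by (rule poly_eqI) (simp add: coeff_map_poly coeff_mult)

lemma map_poly_of_real_power:
  "map_poly of_real (p ^ n) = (map_poly of_real p :: 'a::{real_algebra_1,comm_ring_1} poly) ^ n"
  by (induction n) (simp_all add: map_poly_of_real_mult)

lemma map_poly_of_real_monom:
  "map_poly of_real (monom c n) = monom (of_real c :: 'a::real_algebra_1) n"
  by (rule map_poly_monom) simp

text \<open>The substitution is valid at every complex \<open>z \<noteq> 1\<close>: a zero
  \<open>z\<close> of the h-polynomial gives the zero \<open>z / (1 - z)\<close> of the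
  f-polynomial, and if this is a real \<open>r\<close>, then \<open>z = r / (1 + r)\<close>. The
  assumption \<open>f_poly K \<noteq> 0\<close> rules out the first alternative in
  \<open>real_rooted\<close>.\<close>

lemma real_rooted_h_poly:
  assumes "real_rooted (f_poly K)" "f_poly K \<noteq> 0"
  shows "real_rooted (h_poly K)"
  unfolding real_rooted_def
proof (intro disjI2 allI impI)
  fix z :: complex
  let ?m = "complex_rank K"
  assume z: "poly (map_poly complex_of_real (h_poly K)) z = 0"
  show "z \<in> \<real>"
  proof (cases "z = 1")
    case False
    have "of_nat (num_faces K k) * z ^ k * (1 - z) ^ (?m - k) =
        (1 - z) ^ ?m * (of_nat (num_faces K k) * (z / (1 - z)) ^ k)" if "k \<in> {..?m}" for k
      using False that by (simp add: power_diff power_divide)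
    then have "(\<Sum>k\<le>?m. of_nat (num_faces K k) * z ^ k * (1 - z) ^ (?m - k)) =
        (\<Sum>k\<le>?m. (1 - z) ^ ?m * (of_nat (num_faces K k) * (z / (1 - z)) ^ k))"
      by (rule sum.cong[OF refl])
    then have "poly (map_poly complex_of_real (h_poly K)) z =
        (1 - z) ^ ?m * poly (map_poly complex_of_real (f_poly K)) (z / (1 - z))"
      by (simp add: h_poly_def f_poly_def map_poly_of_real_sum map_poly_of_real_mult
          map_poly_of_real_power map_poly_of_real_monom poly_sum poly_monom map_poly_pCons
          sum_distrib_left)
    with z False have "poly (map_poly complex_of_real (f_poly K)) (z / (1 - z)) = 0" by simp
    then have "z / (1 - z) \<in> \<real>" using assms unfolding real_rooted_def by blast
    then obtain r where r: "z / (1 - z) = of_real r" by (auto elim: Reals_cases)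
    then have "z * of_real (1 + r) = of_real r" using False by (simp add: field_simps)
    \<comment> \<open>If \<open>1 + r\<close> were zero, the equation would give
      \<open>r = 0\<close>, hence \<open>1 + r = 1\<close>.\<close>
    moreover from this have "1 + r \<noteq> 0"
      by (metis add.right_neutral add_cancel_right_left mult_zero_right of_real_0 of_real_eq_iff zero_neq_one)
    ultimately have "z = of_real (r / (1 + r))"
      by (metis nonzero_eq_divide_eq of_real_divide of_real_eq_0_iff)
    then show ?thesis by simp
  qed simp
qed


subsection \<open>The \<open>f\<close>-polynomial of the barycentric subdivision of the boundary of a cube\<close>

text \<open>The polynomial of the subdivided boundary of the \<open>n\<close>-cube. The differential
  recursion serves as the definition because it is the operator of
  \<open>roots_of_derivative_operator\<close> with \<open>a = 2\<close>; the count over faces is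
  recovered in \<open>cube_f_eq_sum\<close>.\<close>

primrec cube_f :: "nat \<Rightarrow> real poly" where
  "cube_f 0 = 1"
| "cube_f (Suc n) = [:1, 2:] * cube_f n + smult 2 ([:0, 1, 1:] * pderiv (cube_f n))"

lemma smult_sum_right: "smult c (sum f A) = (\<Sum>x\<in>A. smult c (f x))"
  by (induction A rule: infinite_finite_induct) (simp_all add: smult_add_right)

text \<open>Pascal's rule splits the binomial coefficient. The part with \<open>n choose j\<close>
  gains a factor 2 and the extra term \<open>j = n\<close>; in the other part the index is shifted,
  which produces \<open>f (Suc j)\<close>.\<close>

lemma sum_binomial_two_power_Suc:
  fixes f :: "nat \<Rightarrow> real poly"
  shows "(\<Sum>j<Suc n. smult (of_nat (Suc n choose j) * 2 ^ (Suc n - j)) (f j)) =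
    smult 2 (f n) + smult 2 (\<Sum>j<n. smult (of_nat (n choose j) * 2 ^ (n - j)) (f j)) +
    (\<Sum>j<n. smult (of_nat (n choose j) * 2 ^ (n - j)) (f (Suc j)))"
proof -
  have "(\<Sum>j<Suc n. smult (of_nat (Suc n choose j) * 2 ^ (Suc n - j)) (f j)) =
      smult (2 ^ Suc n) (f 0) + (\<Sum>j<n. smult (of_nat (n choose Suc j) * 2 ^ (n - j)) (f (Suc j))) +
      (\<Sum>j<n. smult (of_nat (n choose j) * 2 ^ (n - j)) (f (Suc j)))"
    by (simp add: sum.lessThan_Suc_shift sum.distrib[symmetric] ring_distribs smult_add_left del: sum.lessThan_Suc power_Suc)
      (simp add: ac_simps)
  also have "smult (2 ^ Suc n) (f 0) + (\<Sum>j<n. smult (of_nat (n choose Suc j) * 2 ^ (n - j)) (f (Suc j))) =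
      (\<Sum>j<Suc n. smult (of_nat (n choose j) * 2 ^ (Suc n - j)) (f j))"
    by (simp add: sum.lessThan_Suc_shift del: sum.lessThan_Suc power_Suc)
  also have "\<dots> = smult 2 (f n) + smult 2 (\<Sum>j<n. smult (of_nat (n choose j) * 2 ^ (n - j)) (f j))"
    by (simp add: Suc_diff_le smult_sum_right ac_simps)
  finally show ?thesis .
qed

lemma cube_f_eq_sum:
  "cube_f n = 1 + [:0, 1:] * (\<Sum>j<n. smult (of_nat (n choose j) * 2 ^ (n - j)) (cube_f j))"
proof (induction n)
  case 0
  show ?case by simp
next
  case (Suc n)
  define S where "S = (\<Sum>j<n. smult (of_nat (n choose j) * 2 ^ (n - j)) (cube_f j))"
  have S: "cube_f n = 1 + [:0, 1:] * S" using Suc unfolding S_def .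
  have "pderiv S = (\<Sum>j<n. smult (of_nat (n choose j) * 2 ^ (n - j)) (pderiv (cube_f j)))"
    unfolding S_def by (simp add: higher_pderiv_sum[of 1, simplified] pderiv_smult)
  \<comment> \<open>The multipliers are kept as variables \<open>q\<close> and \<open>r\<close>, so
    that they move through the sum as whole factors; the concrete polynomials are substituted
    afterwards.\<close>
  then have "(\<Sum>j<n. smult (of_nat (n choose j) * 2 ^ (n - j)) (q * cube_f j + smult 2 (r * pderiv (cube_f j)))) =
      q * S + smult 2 (r * pderiv S)" for q r
    unfolding S_def
    by (simp add: sum.distrib smult_add_right sum_distrib_left smult_sum_right ac_simps)
  then have "(\<Sum>j<n. smult (of_nat (n choose j) * 2 ^ (n - j)) (cube_f (Suc j))) =
      [:1, 2:] * S + smult 2 ([:0, 1, 1:] * pderiv S)"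
    unfolding cube_f.simps .
  then have "(\<Sum>j<Suc n. smult (of_nat (Suc n choose j) * 2 ^ (Suc n - j)) (cube_f j)) =
      smult 2 (cube_f n) + smult 2 S + ([:1, 2:] * S + smult 2 ([:0, 1, 1:] * pderiv S))"
    unfolding sum_binomial_two_power_Suc S_def by simp
  moreover have "pderiv (cube_f n) = S + [:0, 1:] * pderiv S"
    by (simp add: S pderiv_add pderiv_mult pderiv_pCons)
  \<comment> \<open>Real polynomials that agree as functions are equal, which turns the claim into
    ring arithmetic in the values of \<open>S\<close> and its derivative.\<close>
  ultimately show ?case
    unfolding cube_f.simps by (intro poly_eq_poly_eq_iff[THEN iffD1] ext) (simp add: S algebra_simps)
qed

text \<open>
  \<open>capped_f a n\<close> is the \<open>f\<close>-polynomial for an \<open>\<ell>\<close>-fold capped cubical polytope of dimension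
  \<open>n + 1\<close>, where \<open>a = 2 (\<ell> + 1)\<close>.
\<close>

definition capped_f :: "real \<Rightarrow> nat \<Rightarrow> real poly" where
  "capped_f a n = [:1, 2:] * cube_f n + smult a ([:0, 1, 1:] * pderiv (cube_f n))"

lemma cube_f_Suc: "cube_f (Suc n) = capped_f 2 n"
  by (simp add: capped_f_def)

lemma degree_capped_f_le:
  assumes "degree (cube_f n) \<le> n"
  shows "degree (capped_f a n) \<le> Suc n"
proof -
  have "degree ([:1, 2:] * cube_f n) \<le> degree [:1, 2::real:] + degree (cube_f n)"
    by (rule degree_mult_le)
  also have "\<dots> \<le> Suc n" using assms by simp
  finally have 1: "degree ([:1, 2:] * cube_f n) \<le> Suc n" .
  have "degree (smult a ([:0, 1, 1:] * pderiv (cube_f n))) \<le> Suc n"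
  \<comment> \<open>A constant \<open>cube_f n\<close> is treated apart: its derivative has degree
    0, not -1, so the product bound would be too weak, but the whole term vanishes.\<close>
  proof (cases "pderiv (cube_f n) = 0")
    case False
    then have "degree (cube_f n) > 0" by (simp add: pderiv_eq_0_iff)
    have "degree ([:0, 1, 1:] * pderiv (cube_f n)) \<le> degree [:0, 1, 1::real:] + degree (pderiv (cube_f n))"
      by (rule degree_mult_le)
    also have "\<dots> \<le> Suc n" using assms \<open>degree (cube_f n) > 0\<close> by (simp add: degree_pderiv)
    finally show ?thesis using degree_smult_le le_trans by blast
  qed simp
  with 1 show ?thesis unfolding capped_f_def by (rule degree_add_le)
qed

lemma degree_cube_f_le: "degree (cube_f n) \<le> n"
proof (induction n)
  case (Suc n)
  then show ?case unfolding cube_f_Suc by (rule degree_capped_f_le)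
qed simp

text \<open>Each step of the recursion gains one root in the open interval, by Rolle with
  \<open>a = 2\<close>.\<close>

lemma cube_f_roots:
  "\<exists>A. finite A \<and> card A = n \<and> A \<subseteq> {-1<..<0} \<and> (\<forall>x\<in>A. poly (cube_f n) x = 0)"
proof (induction n)
  case 0
  show ?case by (intro exI[of _ "{}"]) simp
next
  case (Suc n)
  then show ?case unfolding cube_f.simps
    using roots_of_derivative_operator[of 2] by (metis zero_less_numeral)
qed

lemma capped_f_nonzero: "capped_f a n \<noteq> 0"
proof -
  have "poly (cube_f k) 0 = 1" for k
    by (induction k) simp_all
  then have "poly (capped_f a n) 0 = 1" unfolding capped_f_def by simp
  then show ?thesis by auto
qed

text \<open>The \<open>n\<close> roots of \<open>cube_f n\<close> yield \<open>n + 1\<close> roots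
  here, which matches the degree bound.\<close>

lemma real_rooted_capped_f:
  assumes "a > 0"
  shows "real_rooted (capped_f a n)"
proof -
  obtain A where "finite A" "card A = n" "A \<subseteq> {-1<..<0}" "\<forall>x\<in>A. poly (cube_f n) x = 0"
    using cube_f_roots by blast
  with roots_of_derivative_operator[OF assms] obtain Z where
    "finite Z" "card Z = Suc n" "\<forall>z\<in>Z. poly (capped_f a n) z = 0"
    unfolding capped_f_def by metis
  then show ?thesis
    using degree_capped_f_le[OF degree_cube_f_le] by (intro real_rooted_if_card_roots[of Z]) auto
qed


subsection \<open>Chains of faces\<close>

lemma f_poly_eq_sum:
  assumes "finite K" "K \<noteq> {}"
  shows "f_poly K = (\<Sum>S\<in>K. monom 1 (card S))"
proof -
  have "f_poly K = (\<Sum>k\<le>complex_rank K. \<Sum>S | S \<in> K \<and> card S = k. monom 1 (card S))"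
    unfolding f_poly_def num_faces_def by (simp add: of_nat_poly smult_monom flip: of_nat_monom)
  also have "\<dots> = (\<Sum>S\<in>K. monom 1 (card S))"
    using assms by (intro sum.group) (auto simp: complex_rank_def)
  finally show ?thesis .
qed

text \<open>A nonempty finite chain contains its union, which is its largest face; removing it
  leaves a chain of strictly smaller faces.\<close>

lemma barycentric_subdivision_eq_UN:
  "barycentric_subdivision \<C> =
    insert {} (\<Union>G\<in>\<C> - {{}}. insert G ` barycentric_subdivision {H \<in> \<C>. H \<subset> G})"
proof (intro equalityI subsetI)
  fix S assume S: "S \<in> barycentric_subdivision \<C>"
  show "S \<in> insert {} (\<Union>G\<in>\<C> - {{}}. insert G ` barycentric_subdivision {H \<in> \<C>. H \<subset> G})"
  proof (cases "S = {}")
    case False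
    with S have G: "\<Union>S \<in> S"
      by (auto simp: barycentric_subdivision_def intro: Union_in_chain)
    let ?T = "S - {\<Union>S}"
    have "S \<subseteq> \<C> - {{}}" using S by (auto simp: barycentric_subdivision_def subset_chain_def)
    then have "\<Union>S \<in> \<C> - {{}}" using G by (rule subsetD)
    moreover have "?T \<in> barycentric_subdivision {H \<in> \<C>. H \<subset> \<Union>S}"
      using S by (auto simp: barycentric_subdivision_def subset_chain_def)
    moreover have "S = insert (\<Union>S) ?T" using G by blast
    ultimately show ?thesis by blast
  qed simp
next
  fix S assume "S \<in> insert {} (\<Union>G\<in>\<C> - {{}}. insert G ` barycentric_subdivision {H \<in> \<C>. H \<subset> G})"
  then show "S \<in> barycentric_subdivision \<C>"
    by (auto simp: barycentric_subdivision_def subset_chain_def)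
qed

lemma finite_barycentric_subdivision: "finite \<C> \<Longrightarrow> finite (barycentric_subdivision \<C>)"
  by (rule finite_subset[of _ "Pow \<C>"]) (auto simp: barycentric_subdivision_def subset_chain_def)

lemma empty_in_barycentric_subdivision [simp]: "{} \<in> barycentric_subdivision \<C>"
  by (simp add: barycentric_subdivision_def subset_chain_def)

lemma f_poly_barycentric_subdivision:
  assumes "finite \<C>"
  shows "f_poly (barycentric_subdivision \<C>) =
    1 + [:0, 1:] * (\<Sum>G\<in>\<C> - {{}}. f_poly (barycentric_subdivision {H \<in> \<C>. H \<subset> G}))"
proof -
  let ?B = "\<lambda>G. barycentric_subdivision {H \<in> \<C>. H \<subset> G}"
  have eq: "f_poly (barycentric_subdivision \<D>) = (\<Sum>S\<in>barycentric_subdivision \<D>. monom 1 (card S))"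
    if "\<D> \<subseteq> \<C>" for \<D>
    by (rule f_poly_eq_sum) (use that assms finite_subset finite_barycentric_subdivision
        empty_in_barycentric_subdivision in \<open>blast+\<close>)
  have fin: "finite (?B G)" for G
    using assms by (intro finite_barycentric_subdivision) simp
  have below: "H \<subset> G" if "S \<in> ?B G" "H \<in> S" for S G H
    using that by (auto simp: barycentric_subdivision_def subset_chain_def)
  \<comment> \<open>Two different top faces of the same chain would each lie strictly below the
    other.\<close>
  have disj: "insert G ` ?B G \<inter> insert G' ` ?B G' = {}" if "G \<noteq> G'" for G G'
  proof -
    have False if "insert G S = insert G' S'" "S \<in> ?B G" "S' \<in> ?B G'" for S S'
    proof -
      have "G \<in> S'" "G' \<in> S" using that(1) \<open>G \<noteq> G'\<close> by blast+
      then show False using below[OF that(3)] below[OF that(2)] by (meson less_asym)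
    qed
    then show ?thesis by blast
  qed
  have inj: "inj_on (insert G) (?B G)" for G
    by (rule inj_onI) (metis below insert_ident psubset_eq)
  have "f_poly (barycentric_subdivision \<C>) = 1 + (\<Sum>S\<in>(\<Union>G\<in>\<C> - {{}}. insert G ` ?B G). monom 1 (card S))"
    unfolding eq[OF subset_refl] by (subst barycentric_subdivision_eq_UN, subst sum.insert)
      (use assms fin in \<open>auto\<close>)
  also have "(\<Sum>S\<in>(\<Union>G\<in>\<C> - {{}}. insert G ` ?B G). monom 1 (card S)) =
      (\<Sum>G\<in>\<C> - {{}}. \<Sum>S\<in>?B G. monom (1::real) (card (insert G S)))"
    using assms fin disj by (subst sum.UNION_disjoint) (auto simp: sum.reindex[OF inj])
  also have "\<dots> = (\<Sum>G\<in>\<C> - {{}}. \<Sum>S\<in>?B G. [:0, 1:] * monom 1 (card S))"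
  proof (intro sum.cong refl)
    fix G S assume "S \<in> ?B G"
    then have "finite S" by (simp add: barycentric_subdivision_def)
    moreover have "G \<notin> S" using below[OF \<open>S \<in> ?B G\<close>] by blast
    ultimately show "monom (1::real) (card (insert G S)) = [:0, 1:] * monom 1 (card S)"
      by (simp add: monom_Suc)
  qed
  finally show ?thesis
    by (simp add: eq sum_distrib_left)
qed

section \<open>The recursion over proper faces of a polytope\<close>

definition sd_f :: "'a::euclidean_space set \<Rightarrow> real poly" where
  "sd_f P = f_poly (barycentric_subdivision (boundary_complex P))"

lemma finite_boundary_complex: "polytope P \<Longrightarrow> finite (boundary_complex P)"
  unfolding boundary_complex_def using finite_polytope_faces by (rule rev_finite_subset) auto

text \<open>The faces of a face are the faces of \<open>P\<close> inside it, so the recursion over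
  chains stays among boundary complexes.\<close>

lemma boundary_complex_face:
  assumes "G \<in> boundary_complex P"
  shows "{H \<in> boundary_complex P. H \<subset> G} = boundary_complex G"
  using assms face_of_face[of G P] by (auto simp: boundary_complex_def dest: face_of_imp_subset)

lemma sd_f_eq_sum:
  assumes "polytope P"
  shows "sd_f P = 1 + [:0, 1:] * (\<Sum>G\<in>boundary_complex P - {{}}. sd_f G)"
proof -
  have "(\<Sum>G\<in>boundary_complex P - {{}}. f_poly (barycentric_subdivision {H \<in> boundary_complex P. H \<subset> G})) =
      (\<Sum>G\<in>boundary_complex P - {{}}. sd_f G)"
    by (intro sum.cong refl) (simp add: boundary_complex_face sd_f_def)
  then show ?thesis
    using f_poly_barycentric_subdivision[OF finite_boundary_complex[OF assms]] by (simp add: sd_f_def)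
qed


subsection \<open>Combinatorial equivalence\<close>

lemma combinatorially_equivalent_sym:
  assumes "combinatorially_equivalent P Q"
  shows "combinatorially_equivalent Q P"
proof -
  from assms obtain \<phi> where \<phi>: "bij_betw \<phi> {F. F face_of P} {G. G face_of Q}"
    and mono: "\<And>F G. F face_of P \<Longrightarrow> G face_of P \<Longrightarrow> F \<subseteq> G \<longleftrightarrow> \<phi> F \<subseteq> \<phi> G"
    unfolding combinatorially_equivalent_def by blast
  let ?\<psi> = "inv_into {F. F face_of P} \<phi>"
  have "bij_betw ?\<psi> {G. G face_of Q} {F. F face_of P}"
    using \<phi> by (rule bij_betw_inv_into)
  moreover from this have "?\<psi> G face_of P" "\<phi> (?\<psi> G) = G" if "G face_of Q" for G
    using that \<phi> by (auto dest: bij_betwE bij_betw_inv_into_right)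
  ultimately show ?thesis
    unfolding combinatorially_equivalent_def using mono by (intro exI[of _ ?\<psi>]) metis
qed

lemma combinatorially_equivalent_trans:
  assumes "combinatorially_equivalent P Q" "combinatorially_equivalent Q R"
  shows "combinatorially_equivalent P R"
proof -
  from assms(1) obtain \<phi> where \<phi>: "bij_betw \<phi> {F. F face_of P} {G. G face_of Q}"
    "\<And>F G. F face_of P \<Longrightarrow> G face_of P \<Longrightarrow> F \<subseteq> G \<longleftrightarrow> \<phi> F \<subseteq> \<phi> G"
    unfolding combinatorially_equivalent_def by blast
  from assms(2) obtain \<psi> where \<psi>: "bij_betw \<psi> {F. F face_of Q} {G. G face_of R}"
    "\<And>F G. F face_of Q \<Longrightarrow> G face_of Q \<Longrightarrow> F \<subseteq> G \<longleftrightarrow> \<psi> F \<subseteq> \<psi> G"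
    unfolding combinatorially_equivalent_def by blast
  have "\<phi> F face_of Q" if "F face_of P" for F
    using that \<phi>(1) by (auto dest: bij_betwE)
  then show ?thesis
    unfolding combinatorially_equivalent_def
    using bij_betw_trans[OF \<phi>(1) \<psi>(1)] \<phi>(2) \<psi>(2) by (intro exI[of _ "\<psi> \<circ> \<phi>"]) auto
qed

text \<open>This identifies faces of the standard cube, which are translates of smaller standard
  cubes, with those cubes.\<close>

lemma combinatorially_equivalent_translation:
  fixes P :: "'a::euclidean_space set"
  shows "combinatorially_equivalent ((+) a ` P) P"
proof (rule combinatorially_equivalent_sym, unfold combinatorially_equivalent_def, intro exI conjI)
  have inj: "inj ((+) a)" by simp
  have "F \<in> (`) ((+) a) ` {F. F face_of P}" if "F face_of (+) a ` P" for F
  proof -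
    have "F = (+) a ` ((+) (-a) ` F)" by (simp add: image_comp o_def)
    moreover from this have "(+) (-a) ` F face_of P" using that face_of_translation_eq[of a] by metis
    ultimately show ?thesis by blast
  qed
  then show "bij_betw ((`) ((+) a)) {F. F face_of P} {G. G face_of (+) a ` P}"
    unfolding bij_betw_def by (auto simp: inj_on_def inj_image_eq_iff[OF inj])
  show "\<forall>F G. F face_of P \<longrightarrow> G face_of P \<longrightarrow> (F \<subseteq> G) = ((+) a ` F \<subseteq> (+) a ` G)"
    by (simp add: inj_image_subset_iff[OF inj])
qed

text \<open>An isomorphism of face lattices preserves bottom and top, so it restricts to the proper
  nonempty faces; it also restricts to the interval below each face \<open>G\<close>, which is the
  face lattice of \<open>G\<close>.\<close>

lemma combinatorially_equivalent_faces:
  fixes P :: "'a::euclidean_space set" and Q :: "'b::euclidean_space set"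
  assumes "combinatorially_equivalent P Q" "convex P" "convex Q"
  obtains \<phi> where "bij_betw \<phi> (boundary_complex P - {{}}) (boundary_complex Q - {{}})"
    "\<And>G. G \<in> boundary_complex P - {{}} \<Longrightarrow> combinatorially_equivalent G (\<phi> G)"
proof -
  from assms(1) obtain \<phi> where \<phi>: "bij_betw \<phi> {F. F face_of P} {G. G face_of Q}"
    and mono: "\<And>F G. F face_of P \<Longrightarrow> G face_of P \<Longrightarrow> F \<subseteq> G \<longleftrightarrow> \<phi> F \<subseteq> \<phi> G"
    unfolding combinatorially_equivalent_def by blast
  have face: "\<phi> F face_of Q" if "F face_of P" for F
    using that \<phi> by (auto dest: bij_betwE)
  have surj: "\<exists>F. F face_of P \<and> \<phi> F = G" if "G face_of Q" for G
    using that \<phi> unfolding bij_betw_def by (metis (mono_tags, lifting) imageE mem_Collect_eq)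
  have "\<phi> {} = {}" using surj[OF empty_face_of] mono by (metis bot.extremum empty_face_of subset_empty)
  moreover have "\<phi> P = Q"
    using surj[OF face_of_refl[OF \<open>convex Q\<close>]] face mono assms face_of_refl face_of_imp_subset
    by (metis subset_antisym)
  moreover have "P face_of P" using assms by (simp add: face_of_refl)
  moreover from this have "\<phi> ` ({F. F face_of P} - {P, {}}) = \<phi> ` {F. F face_of P} - \<phi> ` {P, {}}"
    using \<phi> by (intro inj_on_image_set_diff) (auto simp: bij_betw_def)
  ultimately have "bij_betw \<phi> ({F. F face_of P} - {P, {}}) ({F. F face_of Q} - {Q, {}})"
    using \<phi> by (auto simp: bij_betw_def intro: inj_on_diff)
  moreover have "{F. F face_of P} - {P, {}} = boundary_complex P - {{}}"
    "{F. F face_of Q} - {Q, {}} = boundary_complex Q - {{}}"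
    unfolding boundary_complex_def by auto
  ultimately have bij: "bij_betw \<phi> (boundary_complex P - {{}}) (boundary_complex Q - {{}})"
    by simp
  have "combinatorially_equivalent G (\<phi> G)" if "G face_of P" for G
    unfolding combinatorially_equivalent_def
  proof (intro exI conjI allI impI)
    have "bij_betw \<phi> {F \<in> {F. F face_of P}. F \<subseteq> G} {H \<in> {H. H face_of Q}. H \<subseteq> \<phi> G}"
      using that \<phi> mono by (intro bij_betw_Collect) auto
    then show "bij_betw \<phi> {F. F face_of G} {H. H face_of \<phi> G}"
      by (simp add: face_of_face[OF that] face_of_face[OF face[OF that]])
    show "F \<subseteq> H \<longleftrightarrow> \<phi> F \<subseteq> \<phi> H" if "F face_of G" "H face_of G" for F H
      using that \<open>G face_of P\<close> by (meson mono face_of_trans)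
  qed
  then show ?thesis using that[OF bij] by (simp add: boundary_complex_def)
qed

lemma combinatorially_equivalent_empty:
  fixes P :: "'a::euclidean_space set"
  assumes "combinatorially_equivalent P ({} :: 'b::euclidean_space set)" "convex P"
  shows "P = {}"
proof -
  from assms obtain \<phi> :: "'a set \<Rightarrow> 'b set" where "bij_betw \<phi> {F. F face_of P} {{}}"
    unfolding combinatorially_equivalent_def by auto
  then have "\<phi> P = \<phi> {} \<Longrightarrow> P = {}" "\<phi> P = {}" "\<phi> {} = {}"
    using face_of_refl[OF \<open>convex P\<close>] by (auto simp: bij_betw_def inj_on_def)
  then show "P = {}" by simp
qed

text \<open>By induction on the dimension: a facet of \<open>P\<close> corresponds to a proper face
  of \<open>Q\<close>, so the dimension drops by exactly one on the left and by at least one on the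
  right.\<close>

lemma combinatorially_equivalent_aff_dim_le:
  fixes P :: "'a::euclidean_space set" and Q :: "'b::euclidean_space set"
  assumes "combinatorially_equivalent P Q" "polytope P" "polytope Q"
  shows "aff_dim P \<le> aff_dim Q"
  using assms
proof (induction "nat (aff_dim P)" arbitrary: P Q rule: less_induct)
  case less
  note convex = less.prems(2,3)[THEN polytope_imp_convex]
  show ?case
  proof (cases "0 < aff_dim P")
    case True
    then obtain F where F: "F facet_of P" using less.prems polytope_facet_exists by blast
    then have dim: "aff_dim F = aff_dim P - 1" and "F \<in> boundary_complex P - {{}}"
      by (auto simp: facet_of_def boundary_complex_def)
    moreover obtain \<phi> where "bij_betw \<phi> (boundary_complex P - {{}}) (boundary_complex Q - {{}})"
      and eq: "\<And>G. G \<in> boundary_complex P - {{}} \<Longrightarrow> combinatorially_equivalent G (\<phi> G)"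
      by (rule combinatorially_equivalent_faces[OF less.prems(1) convex]) blast
    ultimately have "\<phi> F \<in> boundary_complex Q - {{}}" by (auto dest: bij_betwE)
    then have "\<phi> F face_of Q" "\<phi> F \<noteq> Q" by (auto simp: boundary_complex_def)
    then have "aff_dim (\<phi> F) < aff_dim Q" "polytope (\<phi> F)"
      using convex less.prems face_of_aff_dim_lt face_of_polytope_polytope by auto
    moreover have "polytope F"
      using F less.prems face_of_polytope_polytope facet_of_def by blast
    ultimately have "aff_dim F \<le> aff_dim (\<phi> F)"
      using True dim \<open>F \<in> _\<close> by (intro less.hyps eq) auto
    then show ?thesis using dim \<open>aff_dim (\<phi> F) < _\<close> by simp
  next
    \<comment> \<open>Here \<open>P\<close> has dimension -1 or 0; the only case to exclude is an
      empty \<open>Q\<close>, of dimension -1, with a nonempty \<open>P\<close>.\<close>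
    case False
    show ?thesis
    proof (cases "Q = {}")
      case True
      then have "P = {}"
        using combinatorially_equivalent_empty less.prems(1) convex(1) by blast
      then show ?thesis using aff_dim_geq by simp
    next
      case ne: False
      then have "aff_dim Q \<ge> 0" using aff_dim_negative_iff[of Q] by linarith
      with False show ?thesis by simp
    qed
  qed
qed


subsection \<open>Faces of the standard cube\<close>

text \<open>Coordinates in \<open>D\<close> are free, those in \<open>U\<close> are fixed at 1 and
  all others at 0. Writing the face as a translate makes its equivalence to a standard cube
  immediate.\<close>

definition cube_face :: "'a::euclidean_space set \<Rightarrow> 'a set \<Rightarrow> 'a set" where
  "cube_face D U = (+) (\<Sum>U) ` cbox 0 (\<Sum>D)"

lemma inner_sum_Basis_subset:
  assumes "D \<subseteq> Basis" "b \<in> Basis"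
  shows "\<Sum>D \<bullet> b = of_bool (b \<in> D)"
proof -
  have "\<Sum>D \<bullet> b = (\<Sum>i\<in>D. if i = b then 1 else 0)"
    unfolding inner_sum_left by (intro sum.cong) (use assms in \<open>auto simp: inner_Basis\<close>)
  also have "\<dots> = of_bool (b \<in> D)"
    using finite_subset[OF assms(1) finite_Basis] by simp
  finally show ?thesis .
qed

lemma mem_cube_face_iff:
  assumes "D \<subseteq> Basis" "U \<subseteq> Basis"
  shows "x \<in> cube_face D U \<longleftrightarrow>
    (\<forall>b\<in>Basis. of_bool (b \<in> U) \<le> x \<bullet> b \<and> x \<bullet> b \<le> of_bool (b \<in> U) + of_bool (b \<in> D))"
proof -
  have "x \<in> cube_face D U \<longleftrightarrow> x - \<Sum>U \<in> cbox 0 (\<Sum>D)"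
    unfolding cube_face_def by (metis (no_types, lifting) add.commute diff_add_cancel image_iff add_diff_cancel_left')
  also have "\<dots> \<longleftrightarrow> (\<forall>b\<in>Basis. of_bool (b \<in> U) \<le> x \<bullet> b \<and> x \<bullet> b \<le> of_bool (b \<in> U) + of_bool (b \<in> D))"
    using assms by (auto simp: mem_box inner_sum_Basis_subset inner_diff_left algebra_simps)
  finally show ?thesis .
qed

lemma cube_face_empty: "cube_face B {} = cbox 0 (\<Sum>B)"
  by (simp add: cube_face_def)

lemma sum_in_cube_face: "D \<subseteq> Basis \<Longrightarrow> U \<subseteq> Basis \<Longrightarrow> \<Sum>U \<in> cube_face D U"
  by (simp add: mem_cube_face_iff inner_sum_Basis_subset)

text \<open>The least vertex \<open>\<Sum>U\<close> determines \<open>U\<close>, and then the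
  greatest vertex \<open>\<Sum>U + \<Sum>D\<close> determines \<open>D\<close>.\<close>

lemma cube_face_eqD:
  assumes "D \<subseteq> Basis" "U \<subseteq> Basis" "D' \<subseteq> Basis" "U' \<subseteq> Basis" "cube_face D U = cube_face D' U'"
  shows "D = D' \<and> U = U'"
proof -
  have sub: "U' \<subseteq> U" if "D \<subseteq> Basis" "U \<subseteq> Basis" "D' \<subseteq> Basis" "U' \<subseteq> Basis" "cube_face D U = cube_face D' U'"
    for D U D' U' :: "'a set"
  proof -
    have "\<Sum>U \<in> cube_face D' U'" using sum_in_cube_face that by metis
    then have "\<forall>b\<in>Basis. of_bool (b \<in> U') \<le> (of_bool (b \<in> U) :: real)"
      using that by (auto simp: mem_cube_face_iff inner_sum_Basis_subset)
    then show ?thesis using that by (auto simp: of_bool_def split: if_splits)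
  qed
  have "U = U'" using sub[OF assms] sub[OF assms(3,4,1,2) assms(5)[symmetric]] by simp
  have sub: "D \<subseteq> D'" if "D \<subseteq> Basis" "D' \<subseteq> Basis" "cube_face D U = cube_face D' U" for D D'
  proof -
    have "\<Sum>U + \<Sum>D \<in> cube_face D U"
      using that(1) assms(2) by (simp add: mem_cube_face_iff inner_sum_Basis_subset inner_add_left)
    then have "\<Sum>U + \<Sum>D \<in> cube_face D' U" using that by simp
    then have "(\<Sum>U + \<Sum>D) \<bullet> b \<le> of_bool (b \<in> U) + of_bool (b \<in> D')" if "b \<in> Basis" for b
      using that \<open>D' \<subseteq> Basis\<close> assms(2) mem_cube_face_iff by blast
    then have "of_bool (b \<in> D) \<le> (of_bool (b \<in> D') :: real)" if "b \<in> Basis" for b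
      using that \<open>D \<subseteq> Basis\<close> assms(2) by (simp add: inner_sum_Basis_subset inner_add_left)
    then show ?thesis using that by (fastforce simp: of_bool_def split: if_splits)
  qed
  show ?thesis using \<open>U = U'\<close> sub[of D D'] sub[of D' D] assms by auto
qed

lemma cube_face_subset:
  assumes "B \<subseteq> Basis" "D \<subseteq> B" "U \<subseteq> B - D"
  shows "cube_face D U \<subseteq> cube_face B {}"
proof
  fix x assume x: "x \<in> cube_face D U"
  have sub: "D \<subseteq> Basis" "U \<subseteq> Basis" "{} \<subseteq> (Basis :: 'a set)" using assms by auto
  have "0 \<le> x \<bullet> b \<and> x \<bullet> b \<le> of_bool (b \<in> B)" if "b \<in> Basis" for b
  proof -
    have "of_bool (b \<in> U) \<le> x \<bullet> b" "x \<bullet> b \<le> of_bool (b \<in> U) + of_bool (b \<in> D)"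
      using x that mem_cube_face_iff[OF sub(1,2)] by blast+
    moreover have "of_bool (b \<in> U) + of_bool (b \<in> D) \<le> (of_bool (b \<in> B) :: real)"
      using assms by auto
    moreover have "0 \<le> (of_bool (b \<in> U) :: real)" by simp
    ultimately show ?thesis by linarith
  qed
  then show "x \<in> cube_face B {}"
    unfolding mem_cube_face_iff[OF assms(1) sub(3)] by simp
qed

text \<open>Outside \<open>D\<close> every coordinate is at an extreme value of the cube. A convex
  combination with positive weights attains an extreme value only if both endpoints do.\<close>

lemma cube_face_face_of:
  assumes "B \<subseteq> Basis" "D \<subseteq> B" "U \<subseteq> B - D"
  shows "cube_face D U face_of cbox 0 (\<Sum>B)"
proof -
  have sub: "D \<subseteq> Basis" "U \<subseteq> Basis" "{} \<subseteq> (Basis :: 'a set)" using assms by auto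
  note mem = mem_cube_face_iff[OF sub(1,2)] mem_cube_face_iff[OF assms(1) sub(3)]
  show ?thesis
    unfolding cube_face_empty[symmetric] face_of_def
  proof (intro conjI ballI impI)
    show "cube_face D U \<subseteq> cube_face B {}"
      using assms by (rule cube_face_subset)
    show "convex (cube_face D U)"
      unfolding cube_face_def by (intro convex_translation convex_box)
    fix v w x assume vw: "v \<in> cube_face B {}" "w \<in> cube_face B {}" and x: "x \<in> cube_face D U"
      and "x \<in> open_segment v w"
    then obtain u where u: "0 < u" "u < 1" "x = (1 - u) *\<^sub>R v + u *\<^sub>R w"
      by (auto simp: in_segment)
    have "of_bool (b \<in> U) \<le> v \<bullet> b \<and> v \<bullet> b \<le> of_bool (b \<in> U) + of_bool (b \<in> D) \<and>
        of_bool (b \<in> U) \<le> w \<bullet> b \<and> w \<bullet> b \<le> of_bool (b \<in> U) + of_bool (b \<in> D)" if "b \<in> Basis" for b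
    proof -
      have v: "0 \<le> v \<bullet> b" "v \<bullet> b \<le> of_bool (b \<in> B)" and w: "0 \<le> w \<bullet> b" "w \<bullet> b \<le> of_bool (b \<in> B)"
        using vw that unfolding mem by auto
      have x: "of_bool (b \<in> U) \<le> x \<bullet> b" "x \<bullet> b \<le> of_bool (b \<in> U) + of_bool (b \<in> D)"
        using x that unfolding mem by auto
      have xb: "x \<bullet> b = (1 - u) * (v \<bullet> b) + u * (w \<bullet> b)"
        by (simp add: u inner_add_left)
      consider "b \<in> D" | "b \<in> U" "b \<notin> D" | "b \<notin> U" "b \<notin> D" by blast
      then show ?thesis
      proof cases
        case 1
        then show ?thesis using v w assms by (auto simp: subset_iff)
      next
        case 2
        then have "b \<in> B" using assms by auto
        then have "(1 - u) * (1 - v \<bullet> b) \<ge> 0" "u * (1 - w \<bullet> b) \<ge> 0" using u v w by auto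
        moreover have "(1 - u) * (1 - v \<bullet> b) + u * (1 - w \<bullet> b) \<le> 0"
          using x xb 2 by (simp add: algebra_simps)
        ultimately have "(1 - u) * (1 - v \<bullet> b) = 0" "u * (1 - w \<bullet> b) = 0" by linarith+
        then show ?thesis using u 2 by simp
      next
        case 3
        have "(1 - u) * (v \<bullet> b) \<ge> 0" "u * (w \<bullet> b) \<ge> 0" using u v w by auto
        moreover have "(1 - u) * (v \<bullet> b) + u * (w \<bullet> b) \<le> 0" using x xb 3 by simp
        ultimately have "(1 - u) * (v \<bullet> b) = 0" "u * (w \<bullet> b) = 0" by linarith+
        then show ?thesis using u 3 by simp
      qed
    qed
    then show "v \<in> cube_face D U" "w \<in> cube_face D U" unfolding mem by auto
  qed
qed

text \<open>The coordinates of a relative interior point \<open>z\<close> of \<open>G\<close> reveal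
  \<open>D\<close> and \<open>U\<close>. Both inclusions come from prolonging segments from
  \<open>x\<close> slightly beyond \<open>z\<close>: for \<open>x\<close> in \<open>G\<close> the
  prolongation stays in \<open>G\<close>, and for \<open>x\<close> in \<open>cube_face D U\<close>
  it stays in the cube, so that the face property applies.\<close>

lemma face_of_cube_imp_cube_face:
  fixes G :: "'a::euclidean_space set"
  assumes "B \<subseteq> Basis" "G face_of cbox 0 (\<Sum>B)" "G \<noteq> {}"
  shows "\<exists>D U. D \<subseteq> B \<and> U \<subseteq> B - D \<and> G = cube_face D U"
proof -
  have "convex G" using assms face_of_imp_convex by blast
  with assms obtain z where z: "z \<in> rel_interior G" using rel_interior_eq_empty by blast
  then have "z \<in> G" using rel_interior_subset by blast
  define D where "D = {b \<in> B. 0 < z \<bullet> b \<and> z \<bullet> b < 1}"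
  define U where "U = {b \<in> B. z \<bullet> b = 1}"
  have sub: "D \<subseteq> Basis" "U \<subseteq> Basis" "{} \<subseteq> (Basis :: 'a set)"
    using assms(1) unfolding D_def U_def by auto
  have DU: "D \<subseteq> B" "U \<subseteq> B - D" by (auto simp: D_def U_def)
  have "finite D" using sub(1) finite_Basis by (rule finite_subset)
  note mem = mem_cube_face_iff[OF sub(1,2)] mem_cube_face_iff[OF assms(1) sub(3)]
  have GB: "0 \<le> x \<bullet> b" "x \<bullet> b \<le> of_bool (b \<in> B)" if "x \<in> G" "b \<in> Basis" for x b
    using that assms(2)[THEN face_of_imp_subset] unfolding cube_face_empty[symmetric] subset_iff mem
    by auto
  have z0: "z \<bullet> b = 0" if "b \<in> Basis" "b \<notin> U" "b \<notin> D" for b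
    using GB[OF \<open>z \<in> G\<close>, of b] that by (cases "b \<in> B") (auto simp: D_def U_def)
  have "G \<subseteq> cube_face D U"
  proof
    fix x assume "x \<in> G"
    then obtain e where e: "e > 1" "(1 - e) *\<^sub>R x + e *\<^sub>R z \<in> G" (is "?y \<in> G")
      using z convex_rel_interior_iff[OF \<open>convex G\<close> \<open>G \<noteq> {}\<close>] by blast
    have "of_bool (b \<in> U) \<le> x \<bullet> b \<and> x \<bullet> b \<le> of_bool (b \<in> U) + of_bool (b \<in> D)" if "b \<in> Basis" for b
    proof -
      have y: "?y \<bullet> b = (1 - e) * (x \<bullet> b) + e * (z \<bullet> b)" by (simp add: inner_add_left)
      note yb = GB[OF \<open>?y \<in> G\<close> that, unfolded y] and xb = GB[OF \<open>x \<in> G\<close> that]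
      consider "b \<in> D" | "b \<in> U" "b \<notin> D" | "b \<notin> U" "b \<notin> D" by blast
      then show ?thesis
      proof cases
        case 1
        then show ?thesis using xb by (auto simp: D_def U_def)
      next
        case 2
        then have "(e - 1) * 1 \<le> (e - 1) * (x \<bullet> b)" using yb by (auto simp: U_def algebra_simps)
        then have "1 \<le> x \<bullet> b" using e by (simp del: mult_1_right)
        then show ?thesis using xb 2 by (auto simp: U_def)
      next
        case 3
        then have "(e - 1) * (x \<bullet> b) \<le> 0" using yb z0[OF that] by (auto simp: algebra_simps)
        then have "x \<bullet> b \<le> 0" using e by (simp add: mult_le_0_iff)
        then show ?thesis using xb 3 by auto
      qed
    qed
    then show "x \<in> cube_face D U" unfolding mem by blast
  qed
  moreover have "cube_face D U \<subseteq> G"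
  proof
    fix x assume x: "x \<in> cube_face D U"
    have xB: "x \<in> cube_face B {}"
      using cube_face_subset[OF assms(1) DU] x by (rule subsetD)
    \<comment> \<open>Since free coordinates of \<open>z\<close> and \<open>x\<close> differ by at
      most 1, a step of length \<open>t\<close> from \<open>z\<close> keeps them in the unit
      interval. The inserted 1 covers an empty \<open>D\<close>.\<close>
    define t where "t = Min (insert 1 ((\<lambda>b. min (z \<bullet> b) (1 - z \<bullet> b)) ` D))"
    have "t > 0" using \<open>finite D\<close> unfolding t_def by (simp add: D_def)
    have t: "t \<le> z \<bullet> b" "t \<le> 1 - z \<bullet> b" if "b \<in> D" for b
    proof -
      have "t \<le> min (z \<bullet> b) (1 - z \<bullet> b)" unfolding t_def using \<open>finite D\<close> that by (intro Min_le) auto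
      then show "t \<le> z \<bullet> b" "t \<le> 1 - z \<bullet> b" by auto
    qed
    define w where "w = z + t *\<^sub>R (z - x)"
    have "0 \<le> w \<bullet> b \<and> w \<bullet> b \<le> of_bool (b \<in> B)" if "b \<in> Basis" for b
    proof -
      have w: "w \<bullet> b = z \<bullet> b + t * (z \<bullet> b - x \<bullet> b)"
        by (simp add: w_def inner_add_left inner_diff_left)
      have xb: "of_bool (b \<in> U) \<le> x \<bullet> b" "x \<bullet> b \<le> of_bool (b \<in> U) + of_bool (b \<in> D)"
        using x that unfolding mem by auto
      show ?thesis
      proof (cases "b \<in> D")
        case True
        then have "0 < z \<bullet> b" "z \<bullet> b < 1" "b \<in> B" "b \<notin> U" by (auto simp: D_def U_def)
        then have "t * (z \<bullet> b - x \<bullet> b) \<le> t * 1" "t * (-1) \<le> t * (z \<bullet> b - x \<bullet> b)"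
          using xb \<open>t > 0\<close> True by (intro mult_left_mono; simp)+
        then show ?thesis using w t[OF True] \<open>b \<in> B\<close> by simp
      next
        case False
        have "x \<bullet> b = z \<bullet> b" using xb False z0[OF that] by (cases "b \<in> U") (auto simp: U_def)
        then show ?thesis using w GB[OF \<open>z \<in> G\<close> that] by simp
      qed
    qed
    then have wB: "w \<in> cube_face B {}" unfolding mem by simp
    show "x \<in> G"
    proof (cases "x = z")
      case False
      have "z = (1 - 1 / (1 + t)) *\<^sub>R x + (1 / (1 + t)) *\<^sub>R w"
      proof -
        have "(1 + t) *\<^sub>R z = t *\<^sub>R x + w" by (simp add: w_def algebra_simps)
        then have "z = (1 / (1 + t)) *\<^sub>R (t *\<^sub>R x + w)"
          using \<open>t > 0\<close> by (metis add_pos_pos divide_self_if less_irrefl scaleR_one scaleR_scaleR times_divide_eq_left zero_less_one mult_1)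
        moreover have "t / (1 + t) = 1 - 1 / (1 + t)" using \<open>t > 0\<close> by (simp add: field_simps)
        ultimately show ?thesis by (simp add: scaleR_add_right)
      qed
      moreover have "x \<noteq> w"
      proof
        assume "x = w"
        then have "(1 + t) *\<^sub>R (z - x) = 0" by (simp add: w_def algebra_simps)
        then show False using False \<open>t > 0\<close> by simp
      qed
      ultimately have "z \<in> open_segment x w"
        using \<open>t > 0\<close> by (auto simp: in_segment intro!: exI[of _ "1 / (1 + t)"])
      then show ?thesis
        using face_ofD[OF assms(2)] xB wB \<open>z \<in> G\<close> unfolding cube_face_empty by blast
    qed (use \<open>z \<in> G\<close> in simp)
  qed
  ultimately show ?thesis
    by (intro exI[of _ D] exI[of _ U]) (auto simp: D_def U_def)
qed

text \<open>This prepares the face count: a set \<open>D\<close> of free coordinates leaves one face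
  for each subset \<open>U\<close> of the remaining ones.\<close>

lemma bij_betw_cube_faces:
  fixes B :: "'a::euclidean_space set"
  assumes "B \<subseteq> Basis"
  shows "bij_betw (\<lambda>(D, U). cube_face D U) (SIGMA D:{D. D \<subset> B}. Pow (B - D))
    (boundary_complex (cbox 0 (\<Sum>B)) - {{}})"
proof -
  have proper: "cube_face D U \<noteq> cbox 0 (\<Sum>B)" if "D \<subset> B" "U \<subseteq> B - D" for D U
    using cube_face_eqD[of D U B "{}"] that assms unfolding cube_face_empty by blast
  have nonempty: "cube_face D U \<noteq> {}" if "D \<subset> B" "U \<subseteq> B - D" for D U
    using sum_in_cube_face[of D U] that assms by blast
  have surj: "\<exists>D U. D \<subset> B \<and> U \<subseteq> B - D \<and> G = cube_face D U"
    if G: "G face_of cbox 0 (\<Sum>B)" "G \<noteq> cbox 0 (\<Sum>B)" "G \<noteq> {}" for G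
  proof -
    obtain D U where DU: "D \<subseteq> B" "U \<subseteq> B - D" "G = cube_face D U"
      using face_of_cube_imp_cube_face[OF assms G(1,3)] by blast
    then have "D \<noteq> B" using G(2) by (auto simp: cube_face_empty)
    with DU show ?thesis by blast
  qed
  have "inj_on (\<lambda>(D, U). cube_face D U) (SIGMA D:{D. D \<subset> B}. Pow (B - D))"
    using assms by (intro inj_onI) (auto dest!: cube_face_eqD[rotated 4])
  moreover have "(\<lambda>(D, U). cube_face D U) ` (SIGMA D:{D. D \<subset> B}. Pow (B - D)) \<subseteq>
      boundary_complex (cbox 0 (\<Sum>B)) - {{}}"
  proof (rule image_subsetI)
    fix p assume "p \<in> (SIGMA D:{D. D \<subset> B}. Pow (B - D))"
    then obtain D U where DU: "p = (D, U)" "D \<subset> B" "U \<subseteq> B - D" by auto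
    then have "cube_face D U face_of cbox 0 (\<Sum>B)" by (intro cube_face_face_of[OF assms]) auto
    with DU show "(case p of (D, U) \<Rightarrow> cube_face D U) \<in> boundary_complex (cbox 0 (\<Sum>B)) - {{}}"
      using proper nonempty by (simp add: boundary_complex_def)
  qed
  moreover have "boundary_complex (cbox 0 (\<Sum>B)) - {{}} \<subseteq>
      (\<lambda>(D, U). cube_face D U) ` (SIGMA D:{D. D \<subset> B}. Pow (B - D))"
  proof
    fix G assume "G \<in> boundary_complex (cbox 0 (\<Sum>B)) - {{}}"
    then obtain D U where "D \<subset> B" "U \<subseteq> B - D" "G = cube_face D U"
      using surj[of G] unfolding boundary_complex_def by blast
    then show "G \<in> (\<lambda>(D, U). cube_face D U) ` (SIGMA D:{D. D \<subset> B}. Pow (B - D))"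
      by (intro image_eqI[of _ _ "(D, U)"]) auto
  qed
  ultimately show ?thesis unfolding bij_betw_def by blast
qed

text \<open>The cube contains 0 and lies between the independent set \<open>B\<close> and its
  span.\<close>

lemma aff_dim_standard_cube:
  assumes "B \<subseteq> Basis"
  shows "aff_dim (cbox 0 (\<Sum>B)) = int (card B)"
proof -
  have mem: "x \<in> cbox 0 (\<Sum>B) \<longleftrightarrow> (\<forall>b\<in>Basis. 0 \<le> x \<bullet> b \<and> x \<bullet> b \<le> of_bool (b \<in> B))" for x
    using assms by (auto simp: mem_box inner_sum_Basis_subset)
  have "finite B" using assms finite_subset finite_Basis by blast
  have "B \<subseteq> cbox 0 (\<Sum>B)"
    unfolding subset_iff mem using assms by (auto simp: inner_Basis subset_iff)
  moreover have "cbox 0 (\<Sum>B) \<subseteq> span B"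
  proof
    fix x assume x: "x \<in> cbox 0 (\<Sum>B)"
    have "x = (\<Sum>b\<in>Basis. (x \<bullet> b) *\<^sub>R b)" by (simp add: euclidean_representation)
    also have "\<dots> = (\<Sum>b\<in>B. (x \<bullet> b) *\<^sub>R b)"
      using assms x by (intro sum.mono_neutral_right) (force simp: mem)+
    also have "\<dots> \<in> span B" by (intro span_sum span_scale span_base)
    finally show "x \<in> span B" .
  qed
  ultimately have "dim (cbox 0 (\<Sum>B)) = card B"
    using independent_mono[OF independent_Basis assms] by (intro dim_unique) auto
  moreover have "0 \<in> cbox 0 (\<Sum>B)" by (simp add: mem)
  ultimately show ?thesis by (simp add: aff_dim_zero hull_inc)
qed

section \<open>Chain counts for combinatorial cubes\<close>

lemma sd_f_combinatorially_equivalent_cube: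
  fixes B :: "'a::euclidean_space set" and P :: "'b::euclidean_space set"
  assumes "B \<subseteq> Basis" "polytope P" "combinatorially_equivalent P (cbox 0 (\<Sum>B))"
  shows "sd_f P = cube_f (card B)"
  using assms
proof (induction "card B" arbitrary: B P rule: less_induct)
  case less
  have "finite B" using less.prems finite_subset finite_Basis by blast
  let ?I = "SIGMA D:{D. D \<subset> B}. Pow (B - D)"
  obtain \<phi> where bij: "bij_betw \<phi> (boundary_complex (cbox 0 (\<Sum>B)) - {{}}) (boundary_complex P - {{}})"
    and eq: "\<And>G. G \<in> boundary_complex (cbox 0 (\<Sum>B)) - {{}} \<Longrightarrow> combinatorially_equivalent G (\<phi> G)"
    using combinatorially_equivalent_faces[OF combinatorially_equivalent_sym[OF less.prems(3)]]
      less.prems(2) polytope_imp_convex convex_box by metis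
  have "(\<Sum>G\<in>boundary_complex P - {{}}. sd_f G) = (\<Sum>(D, U)\<in>?I. sd_f (\<phi> (cube_face D U)))"
    using sum.reindex_bij_betw[OF bij_betw_trans[OF bij_betw_cube_faces[OF less.prems(1)] bij], of sd_f]
    by (simp add: case_prod_unfold)
  also have "\<dots> = (\<Sum>(D, U)\<in>?I. cube_f (card D))"
  proof (intro sum.cong refl)
    fix p assume "p \<in> ?I"
    then obtain D U where DU: "p = (D, U)" "D \<subset> B" "U \<subseteq> B - D" by auto
    let ?G = "cube_face D U"
    have G: "?G \<in> boundary_complex (cbox 0 (\<Sum>B)) - {{}}"
      using bij_betwE[OF bij_betw_cube_faces[OF less.prems(1)]] DU by auto
    then have "\<phi> ?G \<in> boundary_complex P - {{}}" using bij by (auto dest: bij_betwE)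
    then have "polytope (\<phi> ?G)"
      using less.prems(2) face_of_polytope_polytope by (auto simp: boundary_complex_def)
    moreover have "combinatorially_equivalent (\<phi> ?G) (cbox 0 (\<Sum>D))"
      using combinatorially_equivalent_trans[OF combinatorially_equivalent_sym[OF eq[OF G]]]
        combinatorially_equivalent_translation unfolding cube_face_def by blast
    ultimately have "sd_f (\<phi> ?G) = cube_f (card D)"
      using DU less.prems(1) \<open>finite B\<close> by (intro less.hyps) (auto simp: psubset_card_mono)
    then show "(case p of (D, U) \<Rightarrow> sd_f (\<phi> (cube_face D U))) = (case p of (D, U) \<Rightarrow> cube_f (card D))"
      by (simp add: DU)
  qed
  \<comment> \<open>The summand depends only on \<open>D\<close>, for which there are
    \<open>2 ^ (card B - card D)\<close> choices of \<open>U\<close>.\<close>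
  also have "\<dots> = (\<Sum>D | D \<subset> B. smult (2 ^ (card B - card D)) (cube_f (card D)))"
    using \<open>finite B\<close> by (subst sum.Sigma[symmetric])
      (auto simp: card_Pow card_Diff_subset finite_subset of_nat_poly psubset_eq intro!: sum.cong)
  also have "\<dots> = (\<Sum>j<card B. \<Sum>D | D \<in> {D. D \<subset> B} \<and> card D = j. smult (2 ^ (card B - card D)) (cube_f (card D)))"
  proof (intro sum.group[symmetric])
    show "finite {D. D \<subset> B}"
      using \<open>finite B\<close> by (intro finite_subset[of "{D. D \<subset> B}" "Pow B"]) auto
    show "card ` {D. D \<subset> B} \<subseteq> {..<card B}"
      using \<open>finite B\<close> by (blast intro: psubset_card_mono)
  qed simp
  also have "\<dots> = (\<Sum>j<card B. smult (of_nat (card B choose j) * 2 ^ (card B - j)) (cube_f j))"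
  proof (intro sum.cong refl)
    fix j assume "j \<in> {..<card B}"
    then have "{D. D \<subset> B \<and> card D = j} = {D. D \<subseteq> B \<and> card D = j}" by auto
    then have "card {D. D \<subset> B \<and> card D = j} = card B choose j"
      using n_subsets[OF \<open>finite B\<close>] by simp
    then show "(\<Sum>D | D \<in> {D. D \<subset> B} \<and> card D = j. smult (2 ^ (card B - card D)) (cube_f (card D))) =
        smult (of_nat (card B choose j) * 2 ^ (card B - j)) (cube_f j)"
      by (simp add: of_nat_poly mult.commute)
  qed
  finally have sum: "(\<Sum>G\<in>boundary_complex P - {{}}. sd_f G) =
      (\<Sum>j<card B. smult (of_nat (card B choose j) * 2 ^ (card B - j)) (cube_f j))" .
  show ?case
    unfolding sd_f_eq_sum[OF less.prems(2)] sum by (rule cube_f_eq_sum[symmetric])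
qed

text \<open>The definition of a combinatorial cube leaves \<open>B\<close> open; the dimension bound
  in both directions gives \<open>card B = n\<close>.\<close>

lemma sd_f_combinatorial_cube:
  fixes P :: "'a::euclidean_space set"
  assumes "combinatorial_cube P" "aff_dim P = int n"
  shows "sd_f P = cube_f n"
proof -
  from assms(1) obtain B :: "'a set"
    where B: "B \<subseteq> Basis" "polytope P" "combinatorially_equivalent P (cbox 0 (\<Sum>B))"
    unfolding combinatorial_cube_def by auto
  have "aff_dim P = aff_dim (cbox 0 (\<Sum>B))"
    using B(2,3) combinatorially_equivalent_sym[OF B(3)]
    by (intro order_antisym combinatorially_equivalent_aff_dim_le polytope_interval)
  then have "card B = n" using assms(2) aff_dim_standard_cube[OF B(1)] by simp
  then show ?thesis using sd_f_combinatorially_equivalent_cube[OF B] by simp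
qed


subsection \<open>Capping\<close>

text \<open>
  The part of the convex set \<open>Q \<union> C\<close> strictly on the side of \<open>Q\<close> of the hyperplane spanned by the
  facet is connected, and \<open>Q\<close> and \<open>C\<close> meet it in disjoint relatively closed sets; so \<open>C\<close> lies on
  the other side.
\<close>

lemma face_of_Int_if_convex_Un:
  fixes Q C :: "'a::euclidean_space set"
  assumes "polytope Q" "closed C" "convex C" "convex (Q \<union> C)" "(Q \<inter> C) face_of Q" "Q \<inter> C \<noteq> Q"
  shows "(Q \<inter> C) face_of C"
proof -
  \<comment> \<open>Faces of polytopes are exposed, which supplies the separating
    hyperplane.\<close>
  have "(Q \<inter> C) exposed_face_of Q"
    using assms by (simp add: exposed_face_of_polyhedron polytope_imp_polyhedron)
  then obtain a b where Q: "Q \<subseteq> {x. a \<bullet> x \<le> b}" and F: "Q \<inter> C = Q \<inter> {x. a \<bullet> x = b}"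
    unfolding exposed_face_of_def by blast
  have "closed Q" using assms(1) by (rule polytope_imp_closed)
  obtain q where q: "q \<in> Q" "a \<bullet> q < b" using Q F assms(6) by force
  have "connected ((Q \<union> C) \<inter> {x. a \<bullet> x < b})"
    using assms by (intro convex_connected convex_Int convex_halfspace_lt)
  moreover have "Q \<inter> C \<inter> ((Q \<union> C) \<inter> {x. a \<bullet> x < b}) = {}" using F by auto
  moreover have "Q \<inter> ((Q \<union> C) \<inter> {x. a \<bullet> x < b}) \<noteq> {}" using q by auto
  ultimately have "C \<inter> ((Q \<union> C) \<inter> {x. a \<bullet> x < b}) = {}"
    using \<open>closed Q\<close> \<open>closed C\<close> connected_closedD[of "(Q \<union> C) \<inter> {x. a \<bullet> x < b}" Q C] by auto
  then have C: "b \<le> a \<bullet> x" if "x \<in> C" for x using that by force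
  \<comment> \<open>The open segment from \<open>x\<close> to \<open>q\<close> lies in
    \<open>Q \<union> C\<close> and strictly on the side of \<open>Q\<close>, so it avoids
    \<open>C\<close>; its endpoint \<open>x\<close> is in \<open>Q\<close> because \<open>Q\<close>
    is closed.\<close>
  have "x \<in> Q" if x: "x \<in> C" "a \<bullet> x = b" for x
  proof -
    have "open_segment x q \<subseteq> Q"
    proof
      fix y assume y: "y \<in> open_segment x q"
      then have "y \<in> Q \<union> C"
        using assms(4) x q by (meson UnI1 UnI2 convex_contains_open_segment subsetD)
      moreover obtain u where "0 < u" "y = (1 - u) *\<^sub>R x + u *\<^sub>R q"
        using y by (auto simp: in_segment)
      then have "a \<bullet> y = (1 - u) * b + u * (a \<bullet> q)" using x by (simp add: inner_add_right)
      moreover have "u * (a \<bullet> q) < u * b" using q \<open>0 < u\<close> by simp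
      ultimately show "y \<in> Q" using C[of y] by (auto simp: algebra_simps)
    qed
    then have "closure (open_segment x q) \<subseteq> Q" using \<open>closed Q\<close> by (rule closure_minimal)
    moreover have "x \<noteq> q" using x q by auto
    ultimately show "x \<in> Q" by (simp add: closure_open_segment subset_iff)
  qed
  then have "Q \<inter> C = C \<inter> {x. a \<bullet> x = b}" using F by auto
  then show ?thesis
    using face_of_Int_supporting_hyperplane_ge[OF \<open>convex C\<close>, of b a] C by metis
qed

text \<open>Inclusion-exclusion over nonempty proper faces: those of \<open>Q\<close> and
  \<open>C\<close> have the facet and its proper faces in common, and the facet itself then
  disappears. The dimension of \<open>Q\<close> is part of the conclusion so that capping steps can
  be iterated.\<close>

lemma sd_f_capped_over:
  fixes P Q :: "'a::euclidean_space set"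
  assumes "capped_over P Q" "aff_dim P = int d"
  obtains n where "d = Suc n" "aff_dim Q = int (Suc n)"
    "sd_f P = sd_f Q + cube_f (Suc n) - [:1, 2:] * cube_f n"
proof -
  from assms obtain C where "polytope P" and cubical: "cubical_polytope Q" and cube: "combinatorial_cube C"
    and dim: "aff_dim C = aff_dim Q" and P: "P = Q \<union> C" and F: "(Q \<inter> C) facet_of Q"
    and bd: "boundary_complex P = (boundary_complex Q \<union> boundary_complex C) - {Q \<inter> C}"
    unfolding capped_over_def by blast
  let ?F = "Q \<inter> C"
  have "polytope Q" "polytope C" using cubical cube by (auto simp: cubical_polytope_def combinatorial_cube_def)
  then have convex: "convex Q" "convex C" "convex P"
    using \<open>polytope P\<close> polytope_imp_convex by blast+
  have FQ: "?F face_of Q" "?F \<noteq> {}" "aff_dim ?F = aff_dim Q - 1" using F by (auto simp: facet_of_def)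
  then have "?F \<noteq> Q" "?F \<noteq> C" using dim by auto
  have "aff_dim ?F \<ge> 0" using FQ(2) using aff_dim_negative_iff[of ?F] by linarith
  have FC: "?F face_of C"
    using \<open>polytope Q\<close> \<open>polytope C\<close> convex FQ \<open>?F \<noteq> Q\<close> P
    by (intro face_of_Int_if_convex_Un) (auto simp: polytope_imp_closed)
  have "polytope ?F" using FC \<open>polytope C\<close> face_of_polytope_polytope by blast
  have "aff_dim Q \<le> aff_dim P" using P by (simp add: aff_dim_subset)
  \<comment> \<open>A facet of \<open>P\<close> is a proper face of \<open>Q\<close> or of
    \<open>C\<close>, both of the same dimension, so
    \<open>aff_dim P - 1 < aff_dim Q\<close>.\<close>
  moreover have "aff_dim P \<le> aff_dim Q"
  proof -
    have "0 < aff_dim P" using FQ(3) \<open>aff_dim ?F \<ge> 0\<close> \<open>aff_dim Q \<le> _\<close> by linarith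
    with \<open>polytope P\<close> obtain H where H: "H facet_of P" using polytope_facet_exists by blast
    then have "H \<in> boundary_complex P" by (auto simp: facet_of_def boundary_complex_def)
    then have "H \<in> boundary_complex Q \<or> H \<in> boundary_complex C" unfolding bd by blast
    then have "aff_dim H < aff_dim Q"
    proof
      assume "H \<in> boundary_complex Q"
      then have "H face_of Q" "H \<noteq> Q" by (simp_all add: boundary_complex_def)
      then show ?thesis by (rule face_of_aff_dim_lt[OF convex(1)])
    next
      assume "H \<in> boundary_complex C"
      then have "H face_of C" "H \<noteq> C" by (simp_all add: boundary_complex_def)
      then show ?thesis unfolding dim[symmetric] by (rule face_of_aff_dim_lt[OF convex(2)])
    qed
    then show ?thesis using H by (simp add: facet_of_def)
  qed
  ultimately have dimQ: "aff_dim Q = int d" using assms(2) by simp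
  then obtain n where d: "d = Suc n"
    using \<open>aff_dim ?F \<ge> 0\<close> FQ(3) by (cases d) auto
  have sdC: "sd_f C = cube_f (Suc n)"
    using cube dim dimQ d sd_f_combinatorial_cube by metis
  have sdF: "sd_f ?F = cube_f n"
    using cubical F dimQ d FQ(3) by (intro sd_f_combinatorial_cube) (auto simp: cubical_polytope_def)
  let ?X = "boundary_complex Q - {{}}" and ?Y = "boundary_complex C - {{}}"
  have fin: "finite ?X" "finite ?Y"
    using finite_boundary_complex \<open>polytope Q\<close> \<open>polytope C\<close> by auto
  have inter: "?X \<inter> ?Y = insert ?F (boundary_complex ?F - {{}})"
  proof (intro equalityI subsetI)
    fix G assume "G \<in> ?X \<inter> ?Y"
    then have "G face_of Q" "G face_of C" "G \<noteq> {}" by (auto simp: boundary_complex_def)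
    then show "G \<in> insert ?F (boundary_complex ?F - {{}})"
      using face_of_face[OF FQ(1), of G] face_of_imp_subset by (auto simp: boundary_complex_def)
  next
    fix G assume G: "G \<in> insert ?F (boundary_complex ?F - {{}})"
    then have "G face_of ?F" "G \<noteq> {}"
      using FQ(2) convex by (auto simp: boundary_complex_def face_of_refl convex_Int)
    then have "G face_of Q" "G face_of C" "G \<subseteq> ?F"
      using FQ(1) FC face_of_trans face_of_imp_subset by metis+
    then show "G \<in> ?X \<inter> ?Y"
      using \<open>G \<noteq> {}\<close> \<open>?F \<noteq> Q\<close> \<open>?F \<noteq> C\<close> by (auto simp: boundary_complex_def)
  qed
  have "?F \<in> ?X \<union> ?Y" "?F \<notin> boundary_complex ?F - {{}}" "finite (boundary_complex ?F - {{}})"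
    using FQ \<open>?F \<noteq> Q\<close> finite_boundary_complex \<open>polytope ?F\<close> by (auto simp: boundary_complex_def)
  moreover have "boundary_complex P - {{}} = (?X \<union> ?Y) - {?F}" unfolding bd by blast
  moreover have "sum sd_f (?X \<union> ?Y) = sum sd_f ?X + sum sd_f ?Y - sum sd_f (?X \<inter> ?Y)"
    using fin by (rule sum_Un)
  \<comment> \<open>The facet is subtracted twice: once as a common face and once because capping
    removes it.\<close>
  ultimately have "sum sd_f (boundary_complex P - {{}}) = sum sd_f ?X + sum sd_f ?Y
      - (sd_f ?F + sum sd_f (boundary_complex ?F - {{}})) - sd_f ?F"
    unfolding inter using fin by (simp add: sum_diff1)
  then have "sd_f P = 1 + [:0, 1:] * (sum sd_f ?X + sum sd_f ?Y
      - (sd_f ?F + sum sd_f (boundary_complex ?F - {{}})) - sd_f ?F)"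
    using sd_f_eq_sum[OF \<open>polytope P\<close>] by simp
  \<comment> \<open>Splitting 1 as 1 + 1 - 1 completes each of the three sums to the recursion for
    \<open>Q\<close>, \<open>C\<close> and the facet.\<close>
  also have "\<dots> = (1 + [:0, 1:] * sum sd_f ?X) + (1 + [:0, 1:] * sum sd_f ?Y)
      - (1 + [:0, 1:] * sum sd_f (boundary_complex ?F - {{}})) - [:0, 2:] * sd_f ?F"
    by (intro poly_eq_poly_eq_iff[THEN iffD1] ext) (simp add: algebra_simps)
  also have "\<dots> = sd_f Q + sd_f C - sd_f ?F - [:0, 2:] * sd_f ?F"
    by (simp only: sd_f_eq_sum[OF \<open>polytope Q\<close>] sd_f_eq_sum[OF \<open>polytope C\<close>]
        sd_f_eq_sum[OF \<open>polytope ?F\<close>])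
  also have "\<dots> = sd_f Q + cube_f (Suc n) - [:1, 2:] * cube_f n"
    unfolding sdC sdF by (intro poly_eq_poly_eq_iff[THEN iffD1] ext) (simp add: algebra_simps)
  finally show ?thesis by (rule that[OF d dimQ[unfolded d]])
qed

text \<open>One capping contributes \<open>capped_f 2 n - [:1, 2:] * cube_f n\<close>, which is just
  the derivative term, so the parameter grows by 2 each time.\<close>

lemma sd_f_capped_cubical:
  assumes "capped_cubical l P" "aff_dim P = int (Suc n)"
  shows "sd_f P = capped_f (2 * real (Suc l)) n"
  using assms
proof induction
  case (cube P)
  then have "sd_f P = cube_f (Suc n)" by (rule sd_f_combinatorial_cube)
  then show ?case by (simp add: cube_f_Suc del: cube_f.simps)
next
  case (cap l Q P)
  obtain m where "Suc n = Suc m" "aff_dim Q = int (Suc m)"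
    "sd_f P = sd_f Q + cube_f (Suc m) - [:1, 2:] * cube_f m"
    by (rule sd_f_capped_over[OF cap.hyps(2) cap.prems])
  with cap.IH have "sd_f P = capped_f (2 * real (Suc l)) n + capped_f 2 n - [:1, 2:] * cube_f n"
    by (simp add: cube_f_Suc del: cube_f.simps)
  also have "\<dots> = capped_f (2 * real (Suc (Suc l))) n"
    unfolding capped_f_def by (intro poly_eq_poly_eq_iff[THEN iffD1] ext) (simp add: algebra_simps)
  finally show ?case .
qed

theorem corollary4p9:
  fixes P :: "'a::euclidean_space set" and d l :: nat
  assumes "capped_cubical l P"
    and "aff_dim P = int d"
  shows "real_rooted (h_poly (barycentric_subdivision (boundary_complex P)))"
proof -
  have "real_rooted (sd_f P) \<and> sd_f P \<noteq> 0"
  \<comment> \<open>\<open>capped_f\<close> describes positive dimensions only. In dimension 0 the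
    polytope is a point with polynomial 1, and a capped polytope cannot occur, because its dimension
    is a successor.\<close>
  proof (cases d)
    case 0
    from assms(1) show ?thesis
    proof cases
      case cube
      then have "sd_f P = 1" using assms(2) 0 sd_f_combinatorial_cube by fastforce
      then show ?thesis using real_rooted_if_card_roots[of "{}"] by simp
    next
      case (cap l' Q)
      then show ?thesis using sd_f_capped_over assms(2) 0 by blast
    qed
  next
    case (Suc n)
    then have "sd_f P = capped_f (2 * real (Suc l)) n"
      using assms sd_f_capped_cubical by blast
    then show ?thesis using real_rooted_capped_f capped_f_nonzero by simp
  qed
  then show ?thesis unfolding sd_f_def by (intro real_rooted_h_poly) auto
qed

end
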